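(* For $n\ge 1$ let $\Gamma_n$ be the Schreier graph at level $n$ of the Hanoi Towers group $H^{(3)}$ on 3 pegs. The family $\{\Gamma_n\}_{n\ge1}$ has uniform volume distribution. More precisely, $\rho_{2/3}(\Gamma_n)\ge \frac12$ for every $n\in\mathbb{N}$, $n\ge 1$.
   Context: Hanoi Towers group: on finite words over the alphabet $\{0,1,2\}$ (the vertices of the rooted ternary tree), for $i\ne j$ in $\{0,1,2\}$ and $x\in\{0,1,2\}\setminus\{i,j\}$ define recursively the automorphism $a_{(ij)}$ by $a_{(ij)}(iw)=jw$, $a_{(ij)}(jw)=iw$, $a_{(ij)}(xw)=x\,a_{(ij)}(w)$ for every word $w$, with the empty word fixed. Put $a=a_{(01)}$, $b=a_{(02)}$, $c=a_{(12)}$ (each an involution); $H^{(3)}$ is the group they generate. $\Gamma_n$ is the Schreier graph of the stabilizer $P_n=\mathrm{st}_{H^{(3)}}(1^n)$ with respect to $\{a,b,c\}$; equivalently, since the action on each level is transitive, its vertex set is the set of $3^n$ words of length $n$ over $\{0,1,2\}$, with $w$ joined to $s(w)$ by an edge for each $s\in\{a,b,c\}$ (giving a loop when $s(w)=w$). It is equipped with the combinatorial (shortest path) metric. $\delta$ denotes diameter. For a finite metric space $X$ and $0<\epsilon<1$, $\rho_\epsilon(X)=\min\{\delta(A)/\delta(X): A\subseteq X,\ |A|\ge\epsilon|X|\}$; for a graph, $\rho_\epsilon(\Gamma)$ is $\rho_\epsilon$ of its vertex set. A family $\{X_i\}$ of finite metric spaces has uniform volume distribution if there exist $\epsilon\in(0,1)$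 and $c>0$ such that $\rho_\epsilon(X_i)\ge c$ for every $i$. *)

theory Defs
  imports
    "HOL-Algebra.Bij"
    "HOL-Algebra.Left_Coset"
    "HOL-Algebra.Generated_Groups"
    "HOL-Algebra.Group_Action"
    "HOL-Analysis.Abstract_Metric_Spaces"
    "HOL-Library.Numeral_Type"
    "Graph_Theory.Shortest_Path"
begin

section \<open>Uniform volume distribution\<close>

definition metric_diameter :: "'a metric \<Rightarrow> 'a set \<Rightarrow> real" where
  "metric_diameter X A =
     (if A = {} then 0 else SUP (x, y) \<in> A \<times> A. mdist X x y)"

text \<open>
  For finite \<open>X\<close> and \<open>\<epsilon> \<le> 1\<close> the minimum is over a finite nonempty set. A quotient by the
  diameter of a one-point space is \<open>0\<close> by the convention on division by zero.
\<close>

definition rho :: "real \<Rightarrow> 'a metric \<Rightarrow> real" where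
  "rho \<epsilon> X =
     Min {metric_diameter X A / metric_diameter X (mspace X) | A.
            A \<subseteq> mspace X \<and> real (card A) \<ge> \<epsilon> * real (card (mspace X))}"

definition uniform_volume_distribution :: "'i set \<Rightarrow> ('i \<Rightarrow> 'a metric) \<Rightarrow> bool" where
  "uniform_volume_distribution I X \<longleftrightarrow>
     (\<forall>i\<in>I. finite (mspace (X i))) \<and>
     (\<exists>\<epsilon> c. 0 < \<epsilon> \<and> \<epsilon> < 1 \<and> 0 < c \<and> (\<forall>i\<in>I. rho \<epsilon> (X i) \<ge> c))"


section \<open>Schreier graphs\<close>

text \<open>
  The cosets are left cosets because permutations are composed as functions and so act from the
  left: for a stabilizer \<open>P\<close> of a point \<open>v\<close>, the coset of \<open>g\<close> corresponds to the point \<open>g v\<close>, and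
  the arc labelled \<open>s\<close> leads from \<open>g v\<close> to \<open>s (g v)\<close>. When \<open>S\<close> consists of involutions, every
  arc has a reverse arc with the same label, so that directed walks are the walks of the
  undirected graph.
\<close>

definition schreier_graph ::
  "('a, 'm) monoid_scheme \<Rightarrow> 'a set \<Rightarrow> 'a set \<Rightarrow> ('a set, 'a set \<times> 'a) pre_digraph" where
  "schreier_graph G P S =
     \<lparr>verts = lcosets\<^bsub>G\<^esub> P,
      arcs = (lcosets\<^bsub>G\<^esub> P) \<times> S,
      tail = fst,
      head = (\<lambda>(C, s). s <#\<^bsub>G\<^esub> C)\<rparr>"

definition graph_dist :: "('v, 'e) pre_digraph \<Rightarrow> 'v \<Rightarrow> 'v \<Rightarrow> real" where
  "graph_dist G u v = real_of_ereal (wf_digraph.\<mu> G (\<lambda>_. 1) u v)"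

text \<open>Meaningful for connected symmetric graphs, where \<^const>\<open>graph_dist\<close> is a metric.\<close>

definition graph_metric :: "('v, 'e) pre_digraph \<Rightarrow> 'v metric" where
  "graph_metric G = metric (verts G, graph_dist G)"


section \<open>The Hanoi Towers group on three pegs\<close>

fun hanoi_swap :: "3 \<Rightarrow> 3 \<Rightarrow> 3 list \<Rightarrow> 3 list" where
  "hanoi_swap i j [] = []"
| "hanoi_swap i j (x # w) =
     (if x = i then j # w else if x = j then i # w else x # hanoi_swap i j w)"

definition hanoi_generators :: "(3 list \<Rightarrow> 3 list) set" where
  "hanoi_generators = {hanoi_swap 0 1, hanoi_swap 0 2, hanoi_swap 1 2}"

text \<open>
  The next two lemmas show that the generators are permutations of the words, so none is lost in
  \<^const>\<open>subgroup_generated\<close>, which intersects its argument with the carrier.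
\<close>

lemma hanoi_swap_involution: "hanoi_swap i j (hanoi_swap i j w) = w"
  by (induction i j w rule: hanoi_swap.induct) auto

lemma hanoi_generators_subset: "hanoi_generators \<subseteq> carrier (BijGroup UNIV)"
  by (auto simp: hanoi_generators_def BijGroup_def Bij_def
      intro!: o_bij[unfolded o_def fun_eq_iff] ext hanoi_swap_involution)

definition hanoi_group :: "(3 list \<Rightarrow> 3 list) monoid" where
  "hanoi_group = subgroup_generated (BijGroup UNIV) hanoi_generators"

definition hanoi_stabilizer :: "nat \<Rightarrow> (3 list \<Rightarrow> 3 list) set" where
  "hanoi_stabilizer n = stabilizer hanoi_group (\<lambda>g. g) (replicate n 1)"

definition hanoi_schreier_graph ::
  "nat \<Rightarrow> ((3 list \<Rightarrow> 3 list) set, (3 list \<Rightarrow> 3 list) set \<times> (3 list \<Rightarrow> 3 list)) pre_digraph" where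
  "hanoi_schreier_graph n = schreier_graph hanoi_group (hanoi_stabilizer n) hanoi_generators"

end

theory Submission
  imports Defs
begin

text \<open>
  A left coset of the stabilizer of \<open>1\<dots>1\<close> is determined by the word to which its elements send
  \<open>1\<dots>1\<close>, so the Schreier graph is the graph of words of length \<open>n\<close>
  (\<open>relpow_arcs_ends_hanoi_schreier_graph\<close>), that is, the state graph of the Towers of Hanoi
  puzzle, where the last letter is the peg of the largest disk. Its diameter is at most
  \<open>2 ^ n - 1\<close> (\<open>level_diameter\<close>). Hence it suffices that every set \<open>A\<close> with two thirds
  of the words contains two words at distance at least \<open>2 ^ (n - 1)\<close>.

  The rotation of the pegs, which adds 1 modulo 3 to every letter, provides such a pair. As \<open>A\<close>
  contains more than half of the words, it meets its image under the rotation, so \<open>A\<close> contains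
  some word \<open>u = w i\<close> together with the rotated word \<open>v = w' j\<close>. Every path from \<open>u\<close> to \<open>v\<close>
  changes the last letter. Let \<open>k\<close> be the third peg. If the last letter goes directly from \<open>i\<close>
  to \<open>j\<close>, then \<open>w\<close> first has to reach the corner \<open>k\<dots>k\<close>, and \<open>w'\<close> has to be reached from
  there. By rotational symmetry the second distance is that of \<open>w\<close> to the corner \<open>j\<dots>j\<close>.
  The distances of \<open>w\<close> to the three corners always add up to \<open>2 (2 ^ (n - 1) - 1)\<close>
  (\<open>corner_dist_sum\<close>), and the one to \<open>i\<dots>i\<close> is at most half of this sum, so the path has
  at least \<open>2 ^ (n - 1)\<close> steps. If the last letter goes via \<open>k\<close>, then the path crosses the copy
  of the level below with last letter \<open>k\<close> from corner to corner, which also takes that long.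

  To avoid decomposing paths, the lower bound is certified by a potential that changes by at most
  one along every move and differs by \<open>2 ^ (n - 1)\<close> between \<open>u\<close> and \<open>v\<close>
  (\<open>rotation_separated\<close>).
\<close>


section \<open>The three pegs as the integers modulo 3\<close>

lemma UNIV_pegs: "(UNIV :: 3 set) = {0, 1, 2}"
proof (rule sym, rule card_subset_eq)
  show "card {0, 1, 2 :: 3} = CARD(3)" by simp
qed auto

lemma peg_cases: obtains "x = (0::3)" | "x = 1" | "x = 2"
  using UNIV_I[of x] unfolding UNIV_pegs by auto

text \<open>For \<open>i \<noteq> j\<close> this is the remaining peg, as the three pegs sum to 0 modulo 3.\<close>

definition third_peg :: "3 \<Rightarrow> 3 \<Rightarrow> 3" where
  "third_peg i j = - i - j"

lemma third_peg_same [simp]: "third_peg i i = i"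
  unfolding third_peg_def by (cases i rule: peg_cases; simp)

lemma third_peg_neq:
  assumes "i \<noteq> j"
  shows "third_peg i j \<noteq> i" "third_peg i j \<noteq> j"
  using assms unfolding third_peg_def
  by (cases i rule: peg_cases; cases j rule: peg_cases; simp)+

lemma third_peg_unique:
  assumes "i \<noteq> j" "k \<noteq> i" "k \<noteq> j"
  shows "third_peg i j = k"
  using assms unfolding third_peg_def
  by (cases i rule: peg_cases; cases j rule: peg_cases; cases k rule: peg_cases; simp)

lemma third_peg_rotate: "third_peg (i + 1) (j + 1) = third_peg i j + 1"
  unfolding third_peg_def by (cases i rule: peg_cases; cases j rule: peg_cases; simp)

lemma sum_third_pegs:
  fixes g :: "3 \<Rightarrow> int"
  shows "g (third_peg 0 x) + g (third_peg 1 x) + g (third_peg 2 x) = g 0 + g 1 + g 2"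
proof -
  have negative: "(- 1 :: 3) = 2" "(- 2 :: 3) = 1" "(- 3 :: 3) = 0" "(- 4 :: 3) = 2"
    by simp_all
  show ?thesis by (cases x rule: peg_cases) (simp_all add: third_peg_def negative)
qed


section \<open>Moves on words\<close>

definition hanoi_moves :: "3 list rel" where
  "hanoi_moves = {(w, s w) | w s. s \<in> hanoi_generators}"

lemma hanoi_swap_commute: "hanoi_swap i j w = hanoi_swap j i w"
  by (induction i j w rule: hanoi_swap.induct) auto

lemma hanoi_moves_iff: "(w, w') \<in> hanoi_moves \<longleftrightarrow> (\<exists>i j. i \<noteq> j \<and> w' = hanoi_swap i j w)"
proof
  assume "(w, w') \<in> hanoi_moves"
  then consider "w' = hanoi_swap 0 1 w" | "w' = hanoi_swap 0 2 w" | "w' = hanoi_swap 1 2 w"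
    by (auto simp: hanoi_moves_def hanoi_generators_def)
  then show "\<exists>i j. i \<noteq> j \<and> w' = hanoi_swap i j w"
  proof cases
    case 1 then show ?thesis by (intro exI[of _ 0] exI[of _ 1]) simp
  next
    case 2 then show ?thesis by (intro exI[of _ 0] exI[of _ 2]) simp
  next
    case 3 then show ?thesis by (intro exI[of _ 1] exI[of _ 2]) simp
  qed
next
  assume "\<exists>i j. i \<noteq> j \<and> w' = hanoi_swap i j w"
  then obtain i j where ij: "i \<noteq> j" "w' = hanoi_swap i j w" by blast
  then have "hanoi_swap i j \<in> hanoi_generators"
    by (cases i rule: peg_cases; cases j rule: peg_cases)
       (auto simp: hanoi_generators_def hanoi_swap_commute fun_eq_iff)
  then show "(w, w') \<in> hanoi_moves"
    using ij by (auto simp: hanoi_moves_def)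
qed

lemma length_hanoi_swap [simp]: "length (hanoi_swap i j w) = length w"
  by (induction i j w rule: hanoi_swap.induct) auto

lemma length_hanoi_moves: "(w, w') \<in> hanoi_moves \<Longrightarrow> length w' = length w"
  by (auto simp: hanoi_moves_iff)

lemma sym_hanoi_moves: "sym hanoi_moves"
  by (auto simp: sym_def hanoi_moves_iff) (metis hanoi_swap_involution)

lemma hanoi_swap_snoc_moving:
  "i \<in> set w \<or> j \<in> set w \<Longrightarrow> hanoi_swap i j (w @ [x]) = hanoi_swap i j w @ [x]"
  by (induction w) auto

lemma hanoi_swap_snoc_fixed:
  "i \<notin> set w \<Longrightarrow> j \<notin> set w \<Longrightarrow> hanoi_swap i j (w @ [x]) = w @ hanoi_swap i j [x]"
  by (induction w) auto

lemma word_avoiding_two_pegs: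
  fixes i j :: 3
  assumes "i \<noteq> j" "i \<notin> set w" "j \<notin> set w"
  shows "w = replicate (length w) (third_peg i j)"
proof (rule replicate_eqI)
  fix y assume "y \<in> set w"
  then show "y = third_peg i j" using assms third_peg_unique[of i j y] by auto
qed simp


section \<open>The diameter of a level\<close>

text \<open>
  A move of \<open>w\<close> that fixes \<open>w\<close> may change the appended letter, so that a loop does not lift to
  the next level. This is why paths are counted here in the reflexive closure of the moves.
\<close>

lemma hanoi_moves_snoc:
  assumes "(w, w') \<in> hanoi_moves\<^sup>="
  shows "(w @ [x], w' @ [x]) \<in> hanoi_moves\<^sup>="
proof (cases "w = w'")
  case False
  with assms obtain i j where ij: "i \<noteq> j" "w' = hanoi_swap i j w"
    by (auto simp: hanoi_moves_iff)
  show ?thesis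
  proof (cases "i \<in> set w \<or> j \<in> set w")
    case True
    have "(w @ [x], hanoi_swap i j (w @ [x])) \<in> hanoi_moves"
      using ij(1) hanoi_moves_iff by blast
    then show ?thesis by (simp add: ij(2) hanoi_swap_snoc_moving[OF True])
  next
    case no: False
    then have "hanoi_swap i j w = w" by (induction w) auto
    with ij False show ?thesis by simp
  qed
qed simp

lemma hanoi_moves_relpow_snoc:
  "(w, w') \<in> hanoi_moves\<^sup>= ^^ m \<Longrightarrow> (w @ [x], w' @ [x]) \<in> hanoi_moves\<^sup>= ^^ m"
proof (induction m arbitrary: w')
  case (Suc m)
  from Suc.prems obtain z
    where "(w, z) \<in> hanoi_moves\<^sup>= ^^ m" "(z, w') \<in> hanoi_moves\<^sup>=" by (rule relpow_Suc_E)
  then show ?case by (intro relpow_Suc_I[OF Suc.IH] hanoi_moves_snoc)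
qed simp

lemma move_last_letter:
  assumes "x \<noteq> y"
  shows "(replicate n (third_peg x y) @ [x], replicate n (third_peg x y) @ [y]) \<in> hanoi_moves"
proof -
  have "hanoi_swap x y (replicate n (third_peg x y) @ [x]) = replicate n (third_peg x y) @ [y]"
    using third_peg_neq[OF assms] by (subst hanoi_swap_snoc_fixed) auto
  then show ?thesis using assms unfolding hanoi_moves_iff by metis
qed

lemma relpow_reflcl_mono:
  assumes "(u, v) \<in> R\<^sup>= ^^ k" "k \<le> m"
  shows "(u, v) \<in> R\<^sup>= ^^ m"
proof -
  have "(v, v) \<in> R\<^sup>= ^^ d" for d by (induction d) auto
  then have "(u, v) \<in> R\<^sup>= ^^ (k + (m - k))" using assms(1) by (blast intro: relpow_trans)
  then show ?thesis using assms(2) by simp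
qed

text \<open>
  The solution of the puzzle: the last letter changes at most once, from \<open>x\<close> to \<open>y\<close>, and this
  costs one step between two journeys to and from the corner of the third peg.
\<close>

lemma level_diameter:
  "length u = n \<Longrightarrow> length v = n \<Longrightarrow> (u, v) \<in> hanoi_moves\<^sup>= ^^ (2 ^ n - 1)"
proof (induction n arbitrary: u v)
  case (Suc n)
  obtain u' x where u: "u = u' @ [x]" "length u' = n"
    using Suc.prems(1) by (metis length_Suc_conv_rev)
  obtain v' y where v: "v = v' @ [y]" "length v' = n"
    using Suc.prems(2) by (metis length_Suc_conv_rev)
  show ?case
  proof (cases "x = y")
    case True
    have "(u, v) \<in> hanoi_moves\<^sup>= ^^ (2 ^ n - 1)"
      unfolding u v True by (intro hanoi_moves_relpow_snoc Suc.IH) (use u v in auto)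
    then show ?thesis by (rule relpow_reflcl_mono) simp
  next
    case False
    let ?c = "replicate n (third_peg x y)"
    have "(u, ?c @ [x]) \<in> hanoi_moves\<^sup>= ^^ (2 ^ n - 1)"
      unfolding u by (intro hanoi_moves_relpow_snoc Suc.IH) (use u in auto)
    moreover have "(?c @ [x], ?c @ [y]) \<in> hanoi_moves\<^sup>= ^^ 1"
      using move_last_letter[OF False] by simp
    moreover have "(?c @ [y], v) \<in> hanoi_moves\<^sup>= ^^ (2 ^ n - 1)"
      unfolding v by (intro hanoi_moves_relpow_snoc Suc.IH) (use v in auto)
    ultimately have "(u, v) \<in> hanoi_moves\<^sup>= ^^ ((2 ^ n - 1) + 1 + (2 ^ n - 1))"
      by (blast intro: relpow_trans)
    then show ?thesis by (rule relpow_reflcl_mono) simp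
  qed
qed simp


section \<open>Potentials that change by at most one along a move\<close>

definition move_lipschitz :: "nat \<Rightarrow> (3 list \<Rightarrow> int) \<Rightarrow> bool" where
  "move_lipschitz n f \<longleftrightarrow>
     (\<forall>w w'. length w = n \<longrightarrow> (w, w') \<in> hanoi_moves \<longrightarrow> \<bar>f w' - f w\<bar> \<le> 1)"

lemma move_lipschitzD:
  "move_lipschitz n f \<Longrightarrow> length w = n \<Longrightarrow> (w, w') \<in> hanoi_moves \<Longrightarrow> \<bar>f w' - f w\<bar> \<le> 1"
  by (auto simp: move_lipschitz_def)

lemma move_lipschitz_relpow:
  assumes "move_lipschitz n f" "(u, v) \<in> hanoi_moves ^^ m" "length u = n"
  shows "f v - f u \<le> int m \<and> length v = n"
  using assms(2)
proof (induction m arbitrary: v)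
  case (Suc m)
  then obtain w where w: "(u, w) \<in> hanoi_moves ^^ m" "(w, v) \<in> hanoi_moves" by auto
  with Suc.IH have "f w - f u \<le> int m" "length w = n" by auto
  with move_lipschitzD[OF assms(1) _ w(2)] length_hanoi_moves[OF w(2)] show ?case by auto
qed (use assms(3) in simp)

text \<open>
  A level consists of three copies of the level below, one for each last letter, joined by a
  triangle of three edges. So it suffices to control a potential on the copies and across these
  edges.
\<close>

lemma move_lipschitz_glue:
  assumes copies: "\<And>x. move_lipschitz n (\<lambda>w. f (w @ [x]))"
    and joins: "\<And>i j k. distinct [i, j, k] \<Longrightarrow>
      \<bar>f (replicate n k @ [j]) - f (replicate n k @ [i])\<bar> \<le> 1"
  shows "move_lipschitz (Suc n) f"
  unfolding move_lipschitz_def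
proof (intro allI impI)
  fix w w' assume len: "length w = Suc n" and "(w, w') \<in> hanoi_moves"
  then obtain i j where ij: "i \<noteq> j" and w': "w' = hanoi_swap i j w"
    by (auto simp: hanoi_moves_iff)
  obtain z x where w: "w = z @ [x]" and z: "length z = n"
    using len by (metis length_Suc_conv_rev)
  show "\<bar>f w' - f w\<bar> \<le> 1"
  proof (cases "i \<in> set z \<or> j \<in> set z")
    case True
    have "(z, hanoi_swap i j z) \<in> hanoi_moves" using ij by (auto simp: hanoi_moves_iff)
    from move_lipschitzD[OF copies z this] show ?thesis
      using hanoi_swap_snoc_moving[OF True] by (simp add: w w')
  next
    case False
    define k where "k = third_peg i j"
    have k: "k \<noteq> i" "k \<noteq> j" using third_peg_neq[OF ij] by (simp_all add: k_def)
    have z': "z = replicate n k"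
      using word_avoiding_two_pegs[OF ij, of z] False z by (simp add: k_def)
    have "w' = z @ hanoi_swap i j [x]" using False by (simp add: w w' hanoi_swap_snoc_fixed)
    then show ?thesis
      using joins[of i j k] joins[of j i k] ij k by (auto simp: w z')
  qed
qed


section \<open>Distances to the corners\<close>

text \<open>
  The number of steps from a word to the corner \<open>p\<dots>p\<close>, read off from the last letter \<open>x\<close>: if
  \<open>x = p\<close>, the last letter stays; otherwise the rest must first be brought to the third
  peg \<open>third_peg p x\<close>, and then \<open>2 ^ n\<close> further steps change the last letter and carry the rest
  from the third peg to \<open>p\<close>. As \<open>third_peg p p = p\<close>, one recursive call serves both cases.
\<close>

fun corner_dist_rev :: "3 \<Rightarrow> 3 list \<Rightarrow> int" where
  "corner_dist_rev p [] = 0"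
| "corner_dist_rev p (x # w) =
     (if x = p then 0 else 2 ^ length w) + corner_dist_rev (third_peg p x) w"

definition corner_dist :: "3 \<Rightarrow> 3 list \<Rightarrow> int" where
  "corner_dist p w = corner_dist_rev p (rev w)"

lemma corner_dist_Nil [simp]: "corner_dist p [] = 0"
  by (simp add: corner_dist_def)

lemma corner_dist_snoc [simp]:
  "corner_dist p (w @ [x]) = (if x = p then 0 else 2 ^ length w) + corner_dist (third_peg p x) w"
  by (simp add: corner_dist_def)

lemma corner_dist_bounds: "0 \<le> corner_dist p w \<and> corner_dist p w \<le> 2 ^ length w - 1"
proof (induction w arbitrary: p rule: rev_induct)
  case (snoc x w)
  show ?case using snoc.IH[of "third_peg p x"] by auto
qed simp

lemma corner_dist_corner:
  "corner_dist p (replicate n q) = (if p = q then 0 else 2 ^ n - 1)"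
proof (induction n arbitrary: p)
  case (Suc n)
  have "replicate (Suc n) q = replicate n q @ [q]" by (simp add: replicate_append_same)
  then have "corner_dist p (replicate (Suc n) q) =
      (if q = p then 0 else 2 ^ n) + corner_dist (third_peg p q) (replicate n q)"
    by simp
  then show ?case
    using third_peg_neq(2)[of p q] by (auto simp: Suc.IH simp del: replicate_Suc)
qed simp

text \<open>
  The last letter is a wrong one for exactly two of the three corners, and \<open>third_peg\<close> with one
  argument fixed permutes the pegs, so the sum satisfies a recursion of its own.
\<close>

lemma corner_dist_sum:
  "corner_dist 0 w + corner_dist 1 w + corner_dist 2 w = 2 * (2 ^ length w - 1)"
proof (induction w rule: rev_induct)
  case (snoc x w)
  show ?case
    using sum_third_pegs[of "\<lambda>p. corner_dist p w" x] snoc.IH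
    by (cases x rule: peg_cases) simp_all
qed simp

lemma corner_dist_sum_distinct:
  assumes "distinct [i, j, k]"
  shows "corner_dist i w + corner_dist j w + corner_dist k w = 2 * (2 ^ length w - 1)"
  using assms corner_dist_sum[of w]
  by (cases i rule: peg_cases; cases j rule: peg_cases; cases k rule: peg_cases; simp)

lemma corner_dist_rotate: "corner_dist (p + 1) (map (\<lambda>x. x + 1) w) = corner_dist p w"
proof (induction w arbitrary: p rule: rev_induct)
  case (snoc x w)
  show ?case using snoc.IH[of "third_peg p x"] by (simp add: third_peg_rotate)
qed simp

lemma move_lipschitz_corner_dist: "move_lipschitz n (corner_dist p)"
proof (induction n arbitrary: p)
  case 0
  show ?case by (auto simp: move_lipschitz_def hanoi_moves_iff)
next
  case (Suc n)
  show ?case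
  proof (rule move_lipschitz_glue)
    fix x
    show "move_lipschitz n (\<lambda>w. corner_dist p (w @ [x]))"
      using Suc.IH[of "third_peg p x"] by (auto simp: move_lipschitz_def length_hanoi_moves)
  next
    fix i j k :: 3 assume "distinct [i, j, k]"
    then have ijk: "i \<noteq> j" "i \<noteq> k" "j \<noteq> k" by auto
    have third: "third_peg i j = k" "third_peg j i = k" "third_peg k i = j" "third_peg k j = i"
      using ijk by (auto intro!: third_peg_unique)
    consider "p = i" | "p = j" | "p = k" using third_peg_unique[of i j] ijk by metis
    then show "\<bar>corner_dist p (replicate n k @ [j]) - corner_dist p (replicate n k @ [i])\<bar> \<le> 1"
    proof cases
      case 1 then show ?thesis using ijk by (simp add: corner_dist_corner third)
    next
      case 2 then show ?thesis using ijk by (simp add: corner_dist_corner third)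
    next
      case 3 then show ?thesis using ijk by (simp add: corner_dist_corner third)
    qed
  qed
qed


section \<open>The rotation of the pegs moves every word far\<close>

lemma rotation_separated:
  assumes len: "length u = Suc n"
    and path: "(u, map (\<lambda>x. x + 1) u) \<in> hanoi_moves ^^ m"
  shows "2 ^ n \<le> m"
proof -
  obtain w i where u: "u = w @ [i]" and w: "length w = n"
    using len by (metis length_Suc_conv_rev)
  define j where "j = i + 1"
  define k where "k = i + 2"
  have ijk: "distinct [i, j, k]" and kj: "j + 1 = k"
    unfolding j_def k_def by (cases i rule: peg_cases; simp)+
  define s where "s = corner_dist k w"
  define t where "t = 2 ^ n - s"
  \<comment> \<open>The potential measures the progress from \<open>u\<close> towards its rotation. In the copies \<open>i\<close> and \<open>j\<close>
    it is the signed distance from \<open>k\<dots>k i\<close>, which lies on the edge that joins them. Clipping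
    at \<open>- s\<close> and \<open>t\<close> limits the total rise to \<open>2 ^ n\<close>: in the copy \<open>k\<close> it can then rise by
    \<open>2 ^ n - 1\<close> from one corner to the other, and the edge from there to the copy \<open>j\<close> adds 1.\<close>
  define F where "F v = (let z = butlast v; x = last v in
      if x = i then max (- s) (- corner_dist k z)
      else if x = j then min t (1 + corner_dist k z)
      else corner_dist j z - s)" for v
  have s: "0 \<le> s" "s \<le> 2 ^ n - 1"
    using corner_dist_bounds[of k w] w by (auto simp: s_def)
  have "move_lipschitz (Suc n) F"
  proof (rule move_lipschitz_glue)
    fix x
    show "move_lipschitz n (\<lambda>v. F (v @ [x]))"
      unfolding move_lipschitz_def
    proof (intro allI impI)
      fix v v' assume v: "length v = n" "(v, v') \<in> hanoi_moves"
      have "\<bar>corner_dist p v' - corner_dist p v\<bar> \<le> 1" for p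
        using move_lipschitzD[OF move_lipschitz_corner_dist v] .
      from this[of j] this[of k] show "\<bar>F (v' @ [x]) - F (v @ [x])\<bar> \<le> 1"
        by (auto simp: F_def)
    qed
  next
    fix a b c :: 3 assume abc: "distinct [a, b, c]"
    have pegs: "x = i \<or> x = j \<or> x = k" for x
      using ijk third_peg_unique[of i j x] third_peg_unique[of i j k] by auto
    have "i \<noteq> j" "i \<noteq> k" "j \<noteq> k" using ijk by auto
    then have at_joins:
      "F (replicate n k @ [i]) = 0" "F (replicate n k @ [j]) = 1"
      "F (replicate n j @ [i]) = - s" "F (replicate n j @ [k]) = - s"
      "F (replicate n i @ [j]) = t" "F (replicate n i @ [k]) = t - 1"
      using s by (auto simp: F_def t_def corner_dist_corner)
    show "\<bar>F (replicate n c @ [b]) - F (replicate n c @ [a])\<bar> \<le> 1"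
      using pegs[of a] pegs[of b] pegs[of c] abc
      by (elim disjE; hypsubst) (simp_all add: at_joins)
  qed
  from move_lipschitz_relpow[OF this path len]
  have "F (map (\<lambda>x. x + 1) u) - F u \<le> int m" by simp
  moreover have "F u = - s" by (simp add: F_def u s_def)
  moreover have "F (map (\<lambda>x. x + 1) u) = t"
  proof -
    have "corner_dist k (map (\<lambda>x. x + 1) w) = corner_dist j w"
      using corner_dist_rotate[of j w] kj by simp
    moreover have "2 ^ n - 1 \<le> corner_dist j w + s"
      using corner_dist_sum_distinct[OF ijk, of w] corner_dist_bounds[of i w] w
      by (simp add: s_def)
    moreover have "map (\<lambda>x. x + 1) u = map (\<lambda>x. x + 1) w @ [j]" by (simp add: u j_def)
    ultimately show ?thesis using ijk by (auto simp: F_def t_def Let_def)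
  qed
  ultimately have "2 ^ n \<le> int m" by (simp add: t_def)
  then have "int (2 ^ n) \<le> int m" by simp
  then show ?thesis by linarith
qed


section \<open>Shortest walks in digraphs\<close>

lemma sym_relpow:
  assumes "sym R" "(u, v) \<in> R ^^ m"
  shows "(v, u) \<in> R ^^ m"
  using assms(2)
proof (induction m arbitrary: v)
  case (Suc m)
  then obtain w where "(u, w) \<in> R ^^ m" "(w, v) \<in> R" by auto
  then have "(w, u) \<in> R ^^ m" "(v, w) \<in> R" using Suc.IH assms(1) by (auto dest: symD)
  then show ?case by (rule relpow_Suc_I2[rotated])
qed simp

lemma relpow_reflcl_imp:
  "(u, v) \<in> R\<^sup>= ^^ m \<Longrightarrow> \<exists>k\<le>m. (u, v) \<in> R ^^ k"
proof (induction m arbitrary: v)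
  case (Suc m)
  then obtain w where "(u, w) \<in> R\<^sup>= ^^ m" and w: "(w, v) \<in> R \<or> w = v" by auto
  then obtain k where "k \<le> m" "(u, w) \<in> R ^^ k" using Suc.IH by blast
  with w have "(\<exists>k\<le>m. (u, v) \<in> R ^^ Suc k) \<or> (\<exists>k\<le>m. (u, v) \<in> R ^^ k)"
    by (metis relpow_Suc_I)
  then show ?case by (meson Suc_le_mono le_SucI)
qed auto

context wf_digraph
begin

lemma awalk_iff_relpow:
  "u \<in> verts G \<Longrightarrow> (\<exists>p. awalk u p v \<and> length p = m) \<longleftrightarrow> (u, v) \<in> arcs_ends G ^^ m"
proof (induction m arbitrary: u)
  case 0
  then show ?case by (auto simp: awalk_Nil_iff)
next
  case (Suc m)
  have "(\<exists>p. awalk u p v \<and> length p = Suc m) \<longleftrightarrow>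
      (\<exists>e\<in>arcs G. u = tail G e \<and> (\<exists>p. awalk (head G e) p v \<and> length p = m))"
    (is "?l \<longleftrightarrow> ?r")
  proof
    assume ?l
    then obtain e p where "awalk u (e # p) v" "length p = m" by (auto simp: length_Suc_conv)
    then have "e \<in> arcs G" "u = tail G e" "awalk (head G e) p v" by (simp_all add: awalk_Cons_iff)
    with \<open>length p = m\<close> show ?r by blast
  next
    assume ?r
    then obtain e p where "e \<in> arcs G" "u = tail G e" "awalk (head G e) p v" "length p = m"
      by blast
    then show ?l by (intro exI[of _ "e # p"]) (simp add: awalk_Cons_iff)
  qed
  also have "\<dots> \<longleftrightarrow> (\<exists>e\<in>arcs G. u = tail G e \<and> (head G e, v) \<in> arcs_ends G ^^ m)"
    using Suc.IH by auto
  also have "\<dots> \<longleftrightarrow> (u, v) \<in> arcs_ends G O arcs_ends G ^^ m"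
    by (auto simp: arcs_ends_def arc_to_ends_def)
  also have "arcs_ends G O arcs_ends G ^^ m = arcs_ends G ^^ Suc m"
    by (simp add: relpow_commute)
  finally show ?case .
qed

lemma graph_dist_eq_Least:
  assumes u: "u \<in> verts G" and k: "(u, v) \<in> arcs_ends G ^^ k"
  shows "graph_dist G u v = real (LEAST m. (u, v) \<in> arcs_ends G ^^ m)"
proof -
  define m where "m = (LEAST m. (u, v) \<in> arcs_ends G ^^ m)"
  have cost: "awalk_cost (\<lambda>_. 1) p = real (length p)" for p :: "'b list"
    by (induction p) auto
  have "(u, v) \<in> arcs_ends G ^^ m" unfolding m_def using k by (rule LeastI)
  then obtain p where p: "awalk u p v" "length p = m" using awalk_iff_relpow[OF u] by blast
  have "\<mu> (\<lambda>_. 1) u v = ereal (real m)"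
  proof (rule antisym)
    show "\<mu> (\<lambda>_. 1) u v \<le> ereal (real m)"
      using min_cost_le_walk_cost[OF p(1), of "\<lambda>_. 1"] by (simp add: cost p(2))
  next
    have "m \<le> length q" if "awalk u q v" for q
      unfolding m_def using that awalk_iff_relpow[OF u] by (blast intro: Least_le)
    then show "ereal (real m) \<le> \<mu> (\<lambda>_. 1) u v"
      unfolding \<mu>_def by (intro INF_greatest) (simp add: cost)
  qed
  then show ?thesis by (simp add: graph_dist_def m_def)
qed

lemma graph_dist_le:
  "u \<in> verts G \<Longrightarrow> (u, v) \<in> arcs_ends G ^^ m \<Longrightarrow> graph_dist G u v \<le> real m"
  by (simp add: graph_dist_eq_Least Least_le)

lemma graph_dist_attained:
  assumes "u \<in> verts G" "(u, v) \<in> arcs_ends G ^^ k"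
  obtains m where "(u, v) \<in> arcs_ends G ^^ m" "graph_dist G u v = real m"
  using graph_dist_eq_Least[OF assms] LeastI[of "\<lambda>m. (u, v) \<in> arcs_ends G ^^ m", OF assms(2)]
  by blast

text \<open>
  The empty infimum is infinite, which \<^const>\<open>real_of_ereal\<close> sends to 0. This matters because
  \<^locale>\<open>Metric_space\<close> demands symmetry and nonnegativity on the whole type.
\<close>

lemma graph_dist_outside:
  "u \<notin> verts G \<or> v \<notin> verts G \<Longrightarrow> graph_dist G u v = 0"
proof -
  assume "u \<notin> verts G \<or> v \<notin> verts G"
  then have "{p. awalk u p v} = {}" using awalk_hd_in_verts awalk_last_in_verts by blast
  then show ?thesis by (simp add: graph_dist_def \<mu>_def top_ereal_def)
qed

lemma Metric_space_graph_dist: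
  assumes sym: "sym (arcs_ends G)"
    and connected: "\<And>u v. u \<in> verts G \<Longrightarrow> v \<in> verts G \<Longrightarrow> \<exists>k. (u, v) \<in> arcs_ends G ^^ k"
  shows "Metric_space (verts G) (graph_dist G)"
proof
  fix u v
  have "graph_dist G u v = graph_dist G v u \<and> 0 \<le> graph_dist G u v"
  proof (cases "u \<in> verts G \<and> v \<in> verts G")
    case True
    have swap: "(u, v) \<in> arcs_ends G ^^ m \<longleftrightarrow> (v, u) \<in> arcs_ends G ^^ m" for m
      using sym_relpow[OF sym] by blast
    obtain k where k: "(u, v) \<in> arcs_ends G ^^ k" using connected True by blast
    then have "graph_dist G u v = real (LEAST m. (u, v) \<in> arcs_ends G ^^ m)"
      using True by (intro graph_dist_eq_Least) auto
    moreover have "graph_dist G v u = real (LEAST m. (u, v) \<in> arcs_ends G ^^ m)"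
      using True k graph_dist_eq_Least[of v u k] by (simp add: swap)
    ultimately show ?thesis by simp
  next
    case False
    then show ?thesis using graph_dist_outside[of u v] graph_dist_outside[of v u] by auto
  qed
  then show "graph_dist G u v = graph_dist G v u" "0 \<le> graph_dist G u v" by auto
next
  fix u v assume uv: "u \<in> verts G" "v \<in> verts G"
  then obtain m where m: "(u, v) \<in> arcs_ends G ^^ m" "graph_dist G u v = real m"
    using connected[of u v] graph_dist_attained by metis
  show "graph_dist G u v = 0 \<longleftrightarrow> u = v"
  proof
    assume "u = v"
    then have "graph_dist G u v \<le> real 0" using uv by (intro graph_dist_le) auto
    then show "graph_dist G u v = 0" using m(2) by simp
  qed (use m in auto)
next
  fix u v w assume uvw: "u \<in> verts G" "v \<in> verts G" "w \<in> verts G"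
  obtain k where k: "(u, v) \<in> arcs_ends G ^^ k" "graph_dist G u v = real k"
    using uvw connected[of u v] graph_dist_attained by metis
  obtain l where l: "(v, w) \<in> arcs_ends G ^^ l" "graph_dist G v w = real l"
    using uvw connected[of v w] graph_dist_attained by metis
  have "graph_dist G u w \<le> real (k + l)"
    using uvw k l by (intro graph_dist_le) (auto intro: relpow_trans)
  then show "graph_dist G u w \<le> graph_dist G u v + graph_dist G v w"
    using k l by simp
qed

end


section \<open>Vertices of the Schreier graph as words\<close>

lemma group_hanoi_group: "group hanoi_group"
  unfolding hanoi_group_def by (simp add: group.group_subgroup_generated group_BijGroup)

lemma hanoi_group_carrier_subset: "carrier hanoi_group \<subseteq> Bij UNIV"
proof -
  have "carrier hanoi_group \<subseteq> carrier (BijGroup UNIV)"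
    unfolding hanoi_group_def carrier_subgroup_generated
    by (rule group.generate_incl[OF group_BijGroup]) simp
  then show ?thesis by (simp add: BijGroup_def)
qed

lemma hanoi_group_mult:
  "g \<in> carrier hanoi_group \<Longrightarrow> h \<in> carrier hanoi_group \<Longrightarrow> (g \<otimes>\<^bsub>hanoi_group\<^esub> h) w = g (h w)"
proof -
  assume "g \<in> carrier hanoi_group" "h \<in> carrier hanoi_group"
  then have "g \<in> Bij UNIV" "h \<in> Bij UNIV" using hanoi_group_carrier_subset by blast+
  then have "g \<otimes>\<^bsub>BijGroup UNIV\<^esub> h = compose UNIV g h" by (simp add: BijGroup_def)
  then show ?thesis by (simp add: hanoi_group_def compose_def)
qed

lemma hanoi_group_one: "\<one>\<^bsub>hanoi_group\<^esub> w = w"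
  by (simp add: hanoi_group_def BijGroup_def)

lemma hanoi_generators_in_group: "hanoi_generators \<subseteq> carrier hanoi_group"
  unfolding hanoi_group_def
  by (rule group.subgroup_generated_subset_carrier_subset[OF group_BijGroup hanoi_generators_subset])

lemma hanoi_generators_inv:
  assumes "s \<in> hanoi_generators"
  shows "inv\<^bsub>BijGroup UNIV\<^esub> s = s"
proof (rule group.inv_equality[OF group_BijGroup])
  show s: "s \<in> carrier (BijGroup UNIV)" using assms hanoi_generators_subset by auto
  then show "s \<otimes>\<^bsub>BijGroup UNIV\<^esub> s = \<one>\<^bsub>BijGroup UNIV\<^esub>"
    using assms hanoi_swap_involution
    by (auto simp: BijGroup_def compose_def fun_eq_iff hanoi_generators_def)
qed (use assms hanoi_generators_subset in auto)

lemma hanoi_group_length: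
  assumes "g \<in> carrier hanoi_group"
  shows "length (g w) = length w"
proof -
  have gen: "length (s w) = length w" if "s \<in> hanoi_generators" for s w
    using that by (auto simp: hanoi_generators_def)
  have "g \<in> generate (BijGroup UNIV) (carrier (BijGroup UNIV) \<inter> hanoi_generators)"
    using assms by (simp add: hanoi_group_def carrier_subgroup_generated)
  then show ?thesis
  proof (induction g arbitrary: w)
    case one
    show ?case by (simp add: BijGroup_def)
  next
    case (incl h)
    then show ?case using gen by auto
  next
    case (inv h)
    then show ?case using gen by (auto simp: hanoi_generators_inv)
  next
    case (eng h1 h2)
    have "h1 \<in> carrier hanoi_group" "h2 \<in> carrier hanoi_group"
      using eng.hyps by (auto simp: hanoi_group_def carrier_subgroup_generated)
    then have "(h1 \<otimes>\<^bsub>BijGroup UNIV\<^esub> h2) w = h1 (h2 w)"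
      using hanoi_group_mult[of h1 h2 w] by (simp add: hanoi_group_def)
    then show ?case using eng.IH by simp
  qed
qed

lemma hanoi_group_transitive:
  assumes "length w = n"
  obtains g where "g \<in> carrier hanoi_group" "g (replicate n 1) = w"
proof -
  have "(replicate n 1, w) \<in> hanoi_moves\<^sup>= ^^ (2 ^ n - 1)"
    using assms by (intro level_diameter) simp_all
  from relpow_reflcl_imp[OF this] obtain k where "(replicate n 1, w) \<in> hanoi_moves ^^ k"
    by (elim exE conjE)
  then have "\<exists>g\<in>carrier hanoi_group. g (replicate n 1) = w"
  proof (induction k arbitrary: w)
    case 0
    have "\<one>\<^bsub>hanoi_group\<^esub> \<in> carrier hanoi_group"
      using group_hanoi_group by (simp add: group.is_monoid monoid.one_closed)
    then show ?case using 0 hanoi_group_one by auto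
  next
    case (Suc k)
    then obtain v where "(replicate n 1, v) \<in> hanoi_moves ^^ k" "(v, w) \<in> hanoi_moves" by auto
    then obtain g s where g: "g \<in> carrier hanoi_group" "g (replicate n 1) = v"
      and s: "s \<in> hanoi_generators" "w = s v"
      using Suc.IH[of v] by (auto simp: hanoi_moves_def)
    have "s \<otimes>\<^bsub>hanoi_group\<^esub> g \<in> carrier hanoi_group"
      using group_hanoi_group g s hanoi_generators_in_group
      by (meson group.is_monoid monoid.m_closed subsetD)
    moreover have "(s \<otimes>\<^bsub>hanoi_group\<^esub> g) (replicate n 1) = w"
      using g s hanoi_generators_in_group by (subst hanoi_group_mult) auto
    ultimately show ?case by blast
  qed
  then show ?thesis using that by blast
qed

text \<open>
  The coset of \<open>g\<close> consists of all group elements that take the base point \<open>1\<dots>1\<close> to the same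
  word as \<open>g\<close>, so that it is determined by this word.
\<close>

definition word_coset :: "nat \<Rightarrow> 3 list \<Rightarrow> (3 list \<Rightarrow> 3 list) set" where
  "word_coset n w = {g \<in> carrier hanoi_group. g (replicate n 1) = w}"

text \<open>
  If \<open>h\<close> and \<open>g\<close> agree on the base point, then the product of the inverse of \<open>g\<close> with \<open>h\<close>
  stabilizes it.
\<close>

lemma l_coset_stabilizer:
  assumes g: "g \<in> carrier hanoi_group"
  shows "g <#\<^bsub>hanoi_group\<^esub> hanoi_stabilizer n = word_coset n (g (replicate n 1))"
proof -
  interpret group hanoi_group by (rule group_hanoi_group)
  show ?thesis
  proof (intro equalityI subsetI)
    fix h assume "h \<in> g <#\<^bsub>hanoi_group\<^esub> hanoi_stabilizer n"
    then show "h \<in> word_coset n (g (replicate n 1))"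
      using g hanoi_group_mult
      by (auto simp: l_coset_def hanoi_stabilizer_def stabilizer_def word_coset_def)
  next
    fix h assume "h \<in> word_coset n (g (replicate n 1))"
    then have h: "h \<in> carrier hanoi_group" "h (replicate n 1) = g (replicate n 1)"
      by (auto simp: word_coset_def)
    define p where "p = inv\<^bsub>hanoi_group\<^esub> g \<otimes>\<^bsub>hanoi_group\<^esub> h"
    have "p (replicate n 1) = (inv\<^bsub>hanoi_group\<^esub> g) (g (replicate n 1))"
      using g h by (simp add: p_def hanoi_group_mult)
    also have "\<dots> = (inv\<^bsub>hanoi_group\<^esub> g \<otimes>\<^bsub>hanoi_group\<^esub> g) (replicate n 1)"
      using g by (intro hanoi_group_mult[symmetric]) simp_all
    also have "\<dots> = replicate n 1"
      unfolding l_inv[OF g] by (rule hanoi_group_one)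
    finally have "p \<in> hanoi_stabilizer n"
      using g h by (simp add: hanoi_stabilizer_def stabilizer_def p_def)
    moreover have "h = g \<otimes>\<^bsub>hanoi_group\<^esub> p"
      using g h by (simp add: p_def inv_solve_left' flip: m_assoc)
    ultimately show "h \<in> g <#\<^bsub>hanoi_group\<^esub> hanoi_stabilizer n"
      by (auto simp: l_coset_def)
  qed
qed

lemma inj_on_word_coset: "inj_on (word_coset n) {w. length w = n}"
proof (rule inj_onI)
  fix u v assume "u \<in> {w. length w = n}" and eq: "word_coset n u = word_coset n v"
  then obtain g where "g \<in> word_coset n u"
    using hanoi_group_transitive[of u n] by (auto simp: word_coset_def)
  with eq show "u = v" by (auto simp: word_coset_def)
qed

lemma lcosets_stabilizer:
  "lcosets\<^bsub>hanoi_group\<^esub> (hanoi_stabilizer n) = word_coset n ` {w. length w = n}"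
proof -
  have "(\<lambda>g. g (replicate n 1)) ` carrier hanoi_group = {w. length w = n}"
  proof (intro equalityI subsetI)
    fix w :: "3 list" assume "w \<in> {w. length w = n}"
    then obtain g where "g \<in> carrier hanoi_group" "g (replicate n 1) = w"
      using hanoi_group_transitive[of w n] by auto
    then show "w \<in> (\<lambda>g. g (replicate n 1)) ` carrier hanoi_group" by blast
  qed (auto simp: hanoi_group_length)
  moreover have "lcosets\<^bsub>hanoi_group\<^esub> (hanoi_stabilizer n) =
      word_coset n ` (\<lambda>g. g (replicate n 1)) ` carrier hanoi_group"
    unfolding LCOSETS_def UNION_singleton_eq_range image_image
    by (intro image_cong refl l_coset_stabilizer)
  ultimately show ?thesis by simp
qed

lemma l_coset_word_coset:
  assumes s: "s \<in> hanoi_generators" and w: "length w = n"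
  shows "s <#\<^bsub>hanoi_group\<^esub> word_coset n w = word_coset n (s w)"
proof -
  interpret group hanoi_group by (rule group_hanoi_group)
  obtain g where g: "g \<in> carrier hanoi_group" "g (replicate n 1) = w"
    using hanoi_group_transitive[OF w] .
  have s': "s \<in> carrier hanoi_group" using s hanoi_generators_in_group by auto
  have "s <#\<^bsub>hanoi_group\<^esub> word_coset n w =
      s <#\<^bsub>hanoi_group\<^esub> (g <#\<^bsub>hanoi_group\<^esub> hanoi_stabilizer n)"
    using g by (simp add: l_coset_stabilizer)
  also have "\<dots> = (s \<otimes>\<^bsub>hanoi_group\<^esub> g) <#\<^bsub>hanoi_group\<^esub> hanoi_stabilizer n"
    using g s' by (intro lcos_m_assoc) (auto simp: hanoi_stabilizer_def stabilizer_def)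
  also have "\<dots> = word_coset n (s w)"
    using g s' by (simp add: l_coset_stabilizer hanoi_group_mult)
  finally show ?thesis .
qed

lemma verts_hanoi_schreier_graph:
  "verts (hanoi_schreier_graph n) = word_coset n ` {w. length w = n}"
  by (simp add: hanoi_schreier_graph_def schreier_graph_def lcosets_stabilizer)

lemma arcs_ends_hanoi_schreier_graph:
  "arcs_ends (hanoi_schreier_graph n) =
     {(word_coset n u, word_coset n v) | u v. length u = n \<and> (u, v) \<in> hanoi_moves}"
proof -
  have "arcs_ends (hanoi_schreier_graph n) =
      {(word_coset n u, s <#\<^bsub>hanoi_group\<^esub> word_coset n u) | u s.
        length u = n \<and> s \<in> hanoi_generators}"
    unfolding arcs_ends_def arc_to_ends_def hanoi_schreier_graph_def schreier_graph_def
      lcosets_stabilizer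
    by force
  also have "\<dots> = {(word_coset n u, word_coset n v) | u v.
      length u = n \<and> (u, v) \<in> hanoi_moves}"
  proof (intro equalityI subsetI; clarify)
    fix u :: "3 list" and s assume "n = length u" "s \<in> hanoi_generators"
    then show "\<exists>u' v. (word_coset (length u) u,
          s <#\<^bsub>hanoi_group\<^esub> word_coset (length u) u) =
        (word_coset (length u) u', word_coset (length u) v) \<and>
        length u' = length u \<and> (u', v) \<in> hanoi_moves"
      by (intro exI[of _ u] exI[of _ "s u"]) (auto simp: hanoi_moves_def l_coset_word_coset)
  next
    fix u v assume "(u, v) \<in> hanoi_moves"
    then obtain s where "s \<in> hanoi_generators" "v = s u" by (auto simp: hanoi_moves_def)
    then show "\<exists>u' s. (word_coset (length u) u, word_coset (length u) v) =
        (word_coset (length u) u', s <#\<^bsub>hanoi_group\<^esub> word_coset (length u) u') \<and>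
        length u' = length u \<and> s \<in> hanoi_generators"
      by (intro exI[of _ u] exI[of _ s]) (simp add: l_coset_word_coset)
  qed
  finally show ?thesis .
qed

lemma wf_digraph_hanoi_schreier_graph: "wf_digraph (hanoi_schreier_graph n)"
proof
  fix e assume "e \<in> arcs (hanoi_schreier_graph n)"
  then have "(tail (hanoi_schreier_graph n) e, head (hanoi_schreier_graph n) e)
      \<in> arcs_ends (hanoi_schreier_graph n)"
    by (auto simp: arcs_ends_def arc_to_ends_def)
  then show "tail (hanoi_schreier_graph n) e \<in> verts (hanoi_schreier_graph n)"
    "head (hanoi_schreier_graph n) e \<in> verts (hanoi_schreier_graph n)"
    by (auto simp: arcs_ends_hanoi_schreier_graph verts_hanoi_schreier_graph length_hanoi_moves)
qed

text \<open>So distances between cosets can be computed on words.\<close>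

lemma relpow_arcs_ends_hanoi_schreier_graph:
  assumes u: "length u = n" and v: "length v = n"
  shows "(word_coset n u, word_coset n v) \<in> arcs_ends (hanoi_schreier_graph n) ^^ m
    \<longleftrightarrow> (u, v) \<in> hanoi_moves ^^ m"
  using v
proof (induction m arbitrary: v)
  case 0
  then show ?case using inj_onD[OF inj_on_word_coset[of n], of u v] u by auto
next
  case (Suc m)
  show ?case
  proof
    assume "(word_coset n u, word_coset n v) \<in> arcs_ends (hanoi_schreier_graph n) ^^ Suc m"
    then obtain C where C: "(word_coset n u, C) \<in> arcs_ends (hanoi_schreier_graph n) ^^ m"
      "(C, word_coset n v) \<in> arcs_ends (hanoi_schreier_graph n)" by auto
    then obtain w v' where w: "C = word_coset n w" "word_coset n v = word_coset n v'"
      "length w = n" "(w, v') \<in> hanoi_moves"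
      by (auto simp: arcs_ends_hanoi_schreier_graph)
    then have "v = v'"
      using inj_onD[OF inj_on_word_coset[of n], of v v'] Suc.prems length_hanoi_moves by auto
    then show "(u, v) \<in> hanoi_moves ^^ Suc m" using C w Suc.IH by auto
  next
    assume "(u, v) \<in> hanoi_moves ^^ Suc m"
    then obtain w where w: "(u, w) \<in> hanoi_moves ^^ m" "(w, v) \<in> hanoi_moves" by auto
    then have len: "length w = n" using length_hanoi_moves Suc.prems by auto
    then have "(word_coset n u, word_coset n w) \<in> arcs_ends (hanoi_schreier_graph n) ^^ m"
      using Suc.IH w by blast
    moreover have "(word_coset n w, word_coset n v) \<in> arcs_ends (hanoi_schreier_graph n)"
      using w len by (auto simp: arcs_ends_hanoi_schreier_graph)
    ultimately show "(word_coset n u, word_coset n v)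
        \<in> arcs_ends (hanoi_schreier_graph n) ^^ Suc m" by auto
  qed
qed

lemma word_coset_in_verts: "length w = n \<Longrightarrow> word_coset n w \<in> verts (hanoi_schreier_graph n)"
  by (auto simp: verts_hanoi_schreier_graph)

lemma level_path:
  assumes "length u = n" "length v = n"
  obtains k where "k \<le> 2 ^ n - 1"
    "(word_coset n u, word_coset n v) \<in> arcs_ends (hanoi_schreier_graph n) ^^ k"
proof -
  obtain k where "k \<le> 2 ^ n - 1" "(u, v) \<in> hanoi_moves ^^ k"
    using relpow_reflcl_imp[OF level_diameter[OF assms]] by (elim exE conjE)
  then show ?thesis
    using that[of k] by (simp only: relpow_arcs_ends_hanoi_schreier_graph[OF assms])
qed

lemma Metric_space_hanoi_schreier_graph:
  "Metric_space (verts (hanoi_schreier_graph n)) (graph_dist (hanoi_schreier_graph n))"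
proof (rule wf_digraph.Metric_space_graph_dist[OF wf_digraph_hanoi_schreier_graph])
  show "sym (arcs_ends (hanoi_schreier_graph n))"
  proof (rule symI)
    fix C D assume "(C, D) \<in> arcs_ends (hanoi_schreier_graph n)"
    then obtain u v where uv: "C = word_coset n u" "D = word_coset n v" "length u = n"
      "(u, v) \<in> hanoi_moves"
      by (auto simp: arcs_ends_hanoi_schreier_graph)
    moreover from this have "(v, u) \<in> hanoi_moves" "length v = n"
      using symD[OF sym_hanoi_moves] length_hanoi_moves by auto
    ultimately show "(D, C) \<in> arcs_ends (hanoi_schreier_graph n)"
      by (auto simp: arcs_ends_hanoi_schreier_graph)
  qed
next
  fix C D assume "C \<in> verts (hanoi_schreier_graph n)" "D \<in> verts (hanoi_schreier_graph n)"
  then obtain u v where "C = word_coset n u" "D = word_coset n v" "length u = n" "length v = n"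
    unfolding verts_hanoi_schreier_graph by blast
  then show "\<exists>k. (C, D) \<in> arcs_ends (hanoi_schreier_graph n) ^^ k"
    using level_path[of u n v] by metis
qed

lemma mspace_hanoi [simp]:
  "mspace (graph_metric (hanoi_schreier_graph n)) = word_coset n ` {w. length w = n}"
  unfolding graph_metric_def Metric_space.mspace_metric[OF Metric_space_hanoi_schreier_graph]
  by (rule verts_hanoi_schreier_graph)

lemma mdist_hanoi:
  "mdist (graph_metric (hanoi_schreier_graph n)) = graph_dist (hanoi_schreier_graph n)"
  unfolding graph_metric_def
  by (rule Metric_space.mdist_metric[OF Metric_space_hanoi_schreier_graph])

lemma mdist_hanoi_le:
  assumes "length u = n" "length v = n"
  shows "mdist (graph_metric (hanoi_schreier_graph n)) (word_coset n u) (word_coset n v) \<le> 2 ^ n - 1"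
proof -
  obtain k where k: "k \<le> 2 ^ n - 1"
    "(word_coset n u, word_coset n v) \<in> arcs_ends (hanoi_schreier_graph n) ^^ k"
    using level_path[OF assms] .
  have "mdist (graph_metric (hanoi_schreier_graph n)) (word_coset n u) (word_coset n v) \<le> real k"
    unfolding mdist_hanoi
    using wf_digraph.graph_dist_le[OF wf_digraph_hanoi_schreier_graph word_coset_in_verts k(2)]
      assms(1) .
  also have "real k \<le> real (2 ^ n - 1)" using k(1) by (rule of_nat_mono)
  also have "\<dots> = 2 ^ n - 1" by (simp add: of_nat_diff)
  finally show ?thesis .
qed

lemma mdist_hanoi_rotation_ge:
  assumes u: "length u = Suc n"
  shows "2 ^ n \<le> mdist (graph_metric (hanoi_schreier_graph (Suc n)))
    (word_coset (Suc n) u) (word_coset (Suc n) (map (\<lambda>x. x + 1) u))"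
proof -
  let ?v = "map (\<lambda>x. x + 1) u"
  have v: "length ?v = Suc n" using u by simp
  obtain k where "(word_coset (Suc n) u, word_coset (Suc n) ?v)
      \<in> arcs_ends (hanoi_schreier_graph (Suc n)) ^^ k"
    using level_path[OF u v] .
  from wf_digraph.graph_dist_attained[OF wf_digraph_hanoi_schreier_graph word_coset_in_verts[OF u] this]
  obtain m where m: "(word_coset (Suc n) u, word_coset (Suc n) ?v)
      \<in> arcs_ends (hanoi_schreier_graph (Suc n)) ^^ m"
    "graph_dist (hanoi_schreier_graph (Suc n)) (word_coset (Suc n) u) (word_coset (Suc n) ?v) = real m" .
  have "2 ^ n \<le> m"
    using rotation_separated[OF u] m(1) by (simp only: relpow_arcs_ends_hanoi_schreier_graph[OF u v])
  then have "real (2 ^ n) \<le> real m" by (rule of_nat_mono)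
  then show ?thesis using m(2) by (simp add: mdist_hanoi)
qed


section \<open>Volume distribution\<close>

lemma metric_diameter_ge:
  assumes "finite A" "x \<in> A" "y \<in> A"
  shows "mdist X x y \<le> metric_diameter X A"
proof -
  have "mdist X x y \<le> (SUP (x, y) \<in> A \<times> A. mdist X x y)"
  proof (rule cSUP_upper2[of _ _ "(x, y)"])
    show "bdd_above ((\<lambda>(x, y). mdist X x y) ` (A \<times> A))"
      by (intro bdd_above_finite finite_imageI finite_cartesian_product assms)
  qed (use assms in simp_all)
  then show ?thesis using assms by (auto simp: metric_diameter_def)
qed

lemma metric_diameter_le:
  assumes "\<And>x y. x \<in> A \<Longrightarrow> y \<in> A \<Longrightarrow> mdist X x y \<le> r" "0 \<le> r"
  shows "metric_diameter X A \<le> r"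
proof (cases "A = {}")
  case False
  then have "(SUP (x, y) \<in> A \<times> A. mdist X x y) \<le> r"
    using assms by (intro cSUP_least) auto
  then show ?thesis using False by (simp add: metric_diameter_def)
qed (simp add: metric_diameter_def assms)

lemma rho_ge:
  assumes fin: "finite (mspace X)" and "\<epsilon> \<le> 1"
    and ge: "\<And>A. A \<subseteq> mspace X \<Longrightarrow> real (card A) \<ge> \<epsilon> * real (card (mspace X)) \<Longrightarrow>
      r \<le> metric_diameter X A / metric_diameter X (mspace X)"
  shows "r \<le> rho \<epsilon> X"
proof -
  let ?S = "{metric_diameter X A / metric_diameter X (mspace X) | A.
            A \<subseteq> mspace X \<and> real (card A) \<ge> \<epsilon> * real (card (mspace X))}"
  have "finite ?S"
    by (rule finite_subset[of _ "(\<lambda>A. metric_diameter X A / metric_diameter X (mspace X)) ` Pow (mspace X)"])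
       (use fin in auto)
  moreover have "\<epsilon> * real (card (mspace X)) \<le> real (card (mspace X))"
    using mult_right_mono[OF \<open>\<epsilon> \<le> 1\<close>, of "real (card (mspace X))"] by simp
  then have "?S \<noteq> {}" by blast
  ultimately show ?thesis unfolding rho_def using ge by (subst Min_ge_iff) auto
qed

lemma meets_image:
  assumes fin: "finite X" and A: "A \<subseteq> X" and inj: "inj_on f A" and f: "f ` A \<subseteq> X"
    and card: "card X < 2 * card A"
  obtains x where "x \<in> A" "f x \<in> A"
proof -
  have "A \<inter> f ` A \<noteq> {}"
  proof
    assume "A \<inter> f ` A = {}"
    then have "card (A \<union> f ` A) = card A + card (f ` A)"
      using fin A f by (intro card_Un_disjoint) (auto intro: finite_subset)
    also have "\<dots> = 2 * card A" using inj by (simp add: card_image)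
    finally show False using card_mono[OF fin, of "A \<union> f ` A"] A f card by simp
  qed
  then show ?thesis using that by blast
qed

lemma finite_words: "finite {w :: 3 list. length w = n}"
  using finite_lists_length_eq[of "UNIV :: 3 set" n] by simp

lemma hanoi_large_subset_diameter:
  assumes A: "A \<subseteq> mspace (graph_metric (hanoi_schreier_graph (Suc n)))"
    and card_A: "real (card A) \<ge> 2 / 3 * real (card (mspace (graph_metric (hanoi_schreier_graph (Suc n)))))"
  shows "2 ^ n \<le> metric_diameter (graph_metric (hanoi_schreier_graph (Suc n))) A"
proof -
  define W where "W = {w :: 3 list. length w = Suc n}"
  define B where "B = {w \<in> W. word_coset (Suc n) w \<in> A}"
  have inj: "inj_on (word_coset (Suc n)) W" unfolding W_def by (rule inj_on_word_coset)
  have fin: "finite W" unfolding W_def by (rule finite_words)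
  have AB: "A = word_coset (Suc n) ` B" using A by (auto simp: B_def W_def)
  have "card A = card B"
    unfolding AB by (rule card_image) (use inj in \<open>auto simp: B_def inj_on_def\<close>)
  moreover have "card (mspace (graph_metric (hanoi_schreier_graph (Suc n)))) = card W"
    using card_image[OF inj] by (simp add: W_def)
  moreover have "replicate (Suc n) 0 \<in> W" by (simp add: W_def)
  then have "0 < card W" using fin by (auto simp: card_gt_0_iff)
  ultimately have card: "card W < 2 * card B" using card_A by simp
  obtain u where u: "u \<in> B" "map (\<lambda>x. x + 1) u \<in> B"
  proof (rule meets_image[OF fin _ _ _ card])
    show "B \<subseteq> W" by (auto simp: B_def)
    show "inj_on (map (\<lambda>x. x + 1)) B" by (rule inj_on_mapI) (auto simp: inj_on_def)
    show "map (\<lambda>x. x + 1) ` B \<subseteq> W" by (auto simp: B_def W_def)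
  qed blast
  have "2 ^ n \<le> mdist (graph_metric (hanoi_schreier_graph (Suc n)))
    (word_coset (Suc n) u) (word_coset (Suc n) (map (\<lambda>x. x + 1) u))"
    using u by (intro mdist_hanoi_rotation_ge) (auto simp: B_def W_def)
  also have "\<dots> \<le> metric_diameter (graph_metric (hanoi_schreier_graph (Suc n))) A"
  proof (rule metric_diameter_ge)
    have "finite B" by (rule finite_subset[OF _ fin]) (auto simp: B_def)
    then show "finite A" by (subst AB) simp
  qed (use u in \<open>simp_all add: B_def\<close>)
  finally show ?thesis .
qed

lemma rho_hanoi:
  assumes "n \<ge> 1"
  shows "rho (2 / 3) (graph_metric (hanoi_schreier_graph n)) \<ge> 1 / 2"
proof -
  obtain k where n: "n = Suc k" using assms by (cases n) auto
  let ?X = "graph_metric (hanoi_schreier_graph (Suc k))"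
  have upper: "metric_diameter ?X (mspace ?X) \<le> 2 ^ Suc k - 1"
  proof (rule metric_diameter_le)
    fix C D assume "C \<in> mspace ?X" "D \<in> mspace ?X"
    then obtain u v where "C = word_coset (Suc k) u" "D = word_coset (Suc k) v"
      "length u = Suc k" "length v = Suc k"
      unfolding mspace_hanoi by blast
    then show "mdist ?X C D \<le> 2 ^ Suc k - 1" using mdist_hanoi_le[of u "Suc k" v] by blast
  next
    show "(0 :: real) \<le> 2 ^ Suc k - 1" using one_le_power[of "2 :: real" "Suc k"] by linarith
  qed
  have "(2 :: real) ^ k \<le> metric_diameter ?X (mspace ?X)"
    by (rule hanoi_large_subset_diameter) auto
  then have pos: "0 < metric_diameter ?X (mspace ?X)"
    by (rule less_le_trans[rotated]) simp
  show ?thesis unfolding n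
  proof (rule rho_ge)
    show "finite (mspace ?X)" by (simp add: finite_words)
  next
    fix A assume "A \<subseteq> mspace ?X" "real (card A) \<ge> 2 / 3 * real (card (mspace ?X))"
    then have "2 ^ k \<le> metric_diameter ?X A" by (rule hanoi_large_subset_diameter)
    with upper pos show "1 / 2 \<le> metric_diameter ?X A / metric_diameter ?X (mspace ?X)"
      by (simp add: field_simps)
  qed simp
qed

theorem theorem10:
  shows "uniform_volume_distribution {n::nat. n \<ge> 1} (\<lambda>n. graph_metric (hanoi_schreier_graph n))
     \<and> (\<forall>n::nat. n \<ge> 1 \<longrightarrow> rho (2 / 3) (graph_metric (hanoi_schreier_graph n)) \<ge> 1 / 2)"
proof -
  have "uniform_volume_distribution {n::nat. n \<ge> 1} (\<lambda>n. graph_metric (hanoi_schreier_graph n))"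
    unfolding uniform_volume_distribution_def
  proof (intro conjI exI ballI)
    show "rho (2 / 3) (graph_metric (hanoi_schreier_graph n)) \<ge> 1 / 2" if "n \<in> {n. n \<ge> 1}" for n
      using that rho_hanoi by blast
  qed (simp_all add: finite_words)
  then show ?thesis using rho_hanoi by blast
qed

end
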